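(* Let $(X,T)$ be a topological dynamical system. Then the following conditions are equivalent: (1) $(X,T)$ is an HY-system. (2) $Trans_{\mathcal F_{wt}}(X,T)=Trans(X,T)\neq\emptyset$. (3) $(X,T)$ is $\mathcal F_{wt}$-point transitive. (4) $(X,T^k)$ is an HY-system for every $k\in\mathbb N$. (5) $(X^k,T^{(k)})$ is an HY-system for every $k\in\mathbb N$, where $X^k=X\times X\times\cdots\times X$ ($k$ times) and $T^{(k)}=T\times T\times\cdots\times T$ ($k$ times).
   Context: A topological dynamical system is a pair $(X,T)$ with $X$ a nonempty compact metric space and $T:X\to X$ continuous. "Opene" means nonempty open; $\mathbb N$ is the set of positive integers. For opene $U,V\subset X$ and $x\in X$: $N(U,V)=\{n\in\mathbb Z_+: U\cap T^{-n}V\ne\emptyset\}$, $N(x,U)=\{n\in\mathbb Z_+: T^nx\in U\}$. $(X,T)$ is transitive if $N(U,V)$ is infinite for all opene $U,V$, and totally transitive if $(X,T^k)$ is transitive for every $k\in\mathbb N$. A transitive point is an $x\in X$ whose $\omega$-limit set $\omega(x,T)$ is $X$ (equivalently, $N(x,U)$ is infinite for every opene $U$); $Trans(X,T)$ is the set of transitive points. $(X,T)$ has dense small periodic sets if for every opene $U\subset X$ there are a nonempty closed set $Y\subset U$ and $k\in\mathbb N$ with $T^kY\subset Y$. An HY-system is a totally transitive system with dense small periodic sets. $F\subset\mathbb Z_+$ is thick if for every $n\in\mathbb N$ there is $a_n\in\mathbb Z_+$ with $[a_n,a_n+n]\subset F$; it is weakly thick if there is $k\in\mathbb N$ such that $\{n\in\mathbb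 Z_+: kn\in F\}$ is thick. $\mathcal F_{wt}$ is the family of weakly thick sets. $Trans_{\mathcal F_{wt}}(X,T)$ is the set of $x\in X$ such that $N(x,U)\in\mathcal F_{wt}$ for every opene $U$; $(X,T)$ is $\mathcal F_{wt}$-point transitive if this set is nonempty. *)

theory Defs
  imports "HOL-Analysis.Analysis"
begin

text \<open>
  Spaces are carried by the library type \<^typ>\<open>'a topology\<close>, so that the finite powers \<open>X^k\<close>, with
  \<open>k\<close> quantified inside a statement, are again objects of the same kind.  Every notion below depends
  only on the topology of the underlying compact metric space, so ``compact metric space'' is
  rendered as a compact metrizable topology.  Times range over \<^typ>\<open>nat\<close>, the nonnegative integers.
\<close>

definition tds :: "'a topology \<Rightarrow> ('a \<Rightarrow> 'a) \<Rightarrow> bool" where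
  "tds X T \<longleftrightarrow>
     topspace X \<noteq> {} \<and> compact_space X \<and> metrizable_space X \<and> continuous_map X X T"

definition opene :: "'a topology \<Rightarrow> 'a set \<Rightarrow> bool" where
  "opene X U \<longleftrightarrow> openin X U \<and> U \<noteq> {}"

text \<open>
  The preimage is taken in the whole type; intersecting it with \<open>U \<subseteq> topspace X\<close> makes this the
  preimage in \<open>X\<close>.
\<close>

definition hitting_times :: "('a \<Rightarrow> 'a) \<Rightarrow> 'a set \<Rightarrow> 'a set \<Rightarrow> nat set" where
  "hitting_times T U V = {n. U \<inter> (T ^^ n) -` V \<noteq> {}}"

definition entering_times :: "('a \<Rightarrow> 'a) \<Rightarrow> 'a \<Rightarrow> 'a set \<Rightarrow> nat set" where
  "entering_times T x U = {n. (T ^^ n) x \<in> U}"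

definition transitive_system :: "'a topology \<Rightarrow> ('a \<Rightarrow> 'a) \<Rightarrow> bool" where
  "transitive_system X T \<longleftrightarrow>
     tds X T \<and> (\<forall>U V. opene X U \<longrightarrow> opene X V \<longrightarrow> infinite (hitting_times T U V))"

definition totally_transitive :: "'a topology \<Rightarrow> ('a \<Rightarrow> 'a) \<Rightarrow> bool" where
  "totally_transitive X T \<longleftrightarrow> tds X T \<and> (\<forall>k\<ge>1. transitive_system X (T ^^ k))"

definition omega_limit :: "'a topology \<Rightarrow> ('a \<Rightarrow> 'a) \<Rightarrow> 'a \<Rightarrow> 'a set" where
  "omega_limit X T x = (\<Inter>n. X closure_of {(T ^^ m) x |m. n \<le> m})"

definition Trans :: "'a topology \<Rightarrow> ('a \<Rightarrow> 'a) \<Rightarrow> 'a set" where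
  "Trans X T = {x \<in> topspace X. omega_limit X T x = topspace X}"

definition dense_small_periodic_sets :: "'a topology \<Rightarrow> ('a \<Rightarrow> 'a) \<Rightarrow> bool" where
  "dense_small_periodic_sets X T \<longleftrightarrow>
     (\<forall>U. opene X U \<longrightarrow>
        (\<exists>Y k. closedin X Y \<and> Y \<noteq> {} \<and> Y \<subseteq> U \<and> k \<ge> 1 \<and> (T ^^ k) ` Y \<subseteq> Y))"

definition HY_system :: "'a topology \<Rightarrow> ('a \<Rightarrow> 'a) \<Rightarrow> bool" where
  "HY_system X T \<longleftrightarrow> totally_transitive X T \<and> dense_small_periodic_sets X T"

definition thick :: "nat set \<Rightarrow> bool" where
  "thick F \<longleftrightarrow> (\<forall>n\<ge>1. \<exists>a. {a..a + n} \<subseteq> F)"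

definition weakly_thick :: "nat set \<Rightarrow> bool" where
  "weakly_thick F \<longleftrightarrow> (\<exists>k\<ge>1. thick {n. k * n \<in> F})"

definition F_wt :: "nat set set" where
  "F_wt = {F. weakly_thick F}"

definition Trans_family :: "nat set set \<Rightarrow> 'a topology \<Rightarrow> ('a \<Rightarrow> 'a) \<Rightarrow> 'a set" where
  "Trans_family \<F> X T = {x \<in> topspace X. \<forall>U. opene X U \<longrightarrow> entering_times T x U \<in> \<F>}"

definition point_transitive :: "nat set set \<Rightarrow> 'a topology \<Rightarrow> ('a \<Rightarrow> 'a) \<Rightarrow> bool" where
  "point_transitive \<F> X T \<longleftrightarrow> Trans_family \<F> X T \<noteq> {}"

text \<open>
  A point of \<open>X^k\<close> is a function in the extensional product over the index set \<open>{..<k}\<close>, i.e.\ it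
  takes the value \<^const>\<open>undefined\<close> at all \<open>i \<ge> k\<close>; hence the restriction in the product map.
\<close>

definition power_space :: "'a topology \<Rightarrow> nat \<Rightarrow> (nat \<Rightarrow> 'a) topology" where
  "power_space X k = product_topology (\<lambda>_. X) {..<k}"

definition power_map :: "('a \<Rightarrow> 'a) \<Rightarrow> nat \<Rightarrow> (nat \<Rightarrow> 'a) \<Rightarrow> (nat \<Rightarrow> 'a)" where
  "power_map T k x = (\<lambda>i\<in>{..<k}. T (x i))"

end

theory Submission imports Defs begin

text \<open>
  Every transitive point \<open>x\<close> of an HY-system is \<open>\<F>\<^sub>w\<^sub>t\<close>-transitive: a small set \<open>Y \<subseteq> U\<close> with \<open>T\<^sup>k Y \<subseteq> Y\<close>
  makes \<open>U \<inter> T\<^sup>-\<^sup>k U \<inter> \<dots> \<inter> T\<^sup>-\<^sup>k\<^sup>n U\<close> nonempty, and by total transitivity the \<open>T\<^sup>k\<close>-orbit of \<open>x\<close> meets this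
  open set.  Conversely, if \<open>T\<^sup>k\<^sup>j x\<close> stays in a closed \<open>C \<subseteq> U\<close> for arbitrarily long runs of \<open>j\<close>, then
  by compactness the \<open>T\<^sup>k\<close>-invariant set \<open>\<Inter>j. T\<^sup>-\<^sup>k\<^sup>j C\<close> is nonempty.

  For the powers \<open>X\<^sup>k\<close> one uses Banks' argument for weak mixing: a point of a small periodic set inside
  \<open>U \<inter> T\<^sup>-\<^sup>n V\<close> produces a whole progression \<open>n + k \<nat>\<close> in \<open>N(U, V)\<close>, and transitivity of \<open>T\<^sup>k\<close> lets one
  move along it until a further pair of open sets is hit at the same time.
\<close>

section \<open>Iterates, preimages and working forms of the definitions\<close>

lemma opene_subset: "opene X U \<Longrightarrow> U \<subseteq> topspace X"
  by (simp add: opene_def openin_subset)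

lemma continuous_map_funpow:
  assumes "continuous_map X X T"
  shows "continuous_map X X (T ^^ n)"
proof (induction n)
  case (Suc n)
  then show ?case
    using continuous_map_compose [OF _ assms] by (simp del: o_apply)
qed simp

lemma tds_funpow: "tds X T \<Longrightarrow> tds X (T ^^ k)"
  by (simp add: tds_def continuous_map_funpow)

lemma tds_funpow_in_topspace: "tds X T \<Longrightarrow> x \<in> topspace X \<Longrightarrow> (T ^^ n) x \<in> topspace X"
  by (metis tds_def continuous_map_funpow continuous_map_def PiE Pi_iff)

lemma opene_Int_preimage:
  assumes "tds X T" "opene X U" "opene X V" "x \<in> U" "(T ^^ n) x \<in> V"
  shows "opene X {x \<in> U. (T ^^ n) x \<in> V}"
proof -
  have "openin X (U \<inter> {x \<in> topspace X. (T ^^ n) x \<in> V})"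
    using assms by (intro openin_Int openin_continuous_map_preimage [OF continuous_map_funpow])
      (auto simp: tds_def opene_def)
  moreover have "U \<inter> {x \<in> topspace X. (T ^^ n) x \<in> V} = {x \<in> U. (T ^^ n) x \<in> V}"
    using opene_subset [OF assms(2)] by auto
  ultimately show ?thesis
    using assms by (auto simp: opene_def)
qed

lemma transitive_system_iff:
  "transitive_system X T \<longleftrightarrow>
     tds X T \<and> (\<forall>U V N. opene X U \<longrightarrow> opene X V \<longrightarrow> (\<exists>n\<ge>N. \<exists>x\<in>U. (T ^^ n) x \<in> V))"
  unfolding transitive_system_def infinite_nat_iff_unbounded_le hitting_times_def by blast

lemma totally_transitiveD:
  assumes "totally_transitive X T" "opene X U" "opene X V" "k \<ge> 1"
  obtains m x where "m \<ge> N" "x \<in> U" "(T ^^ (k * m)) x \<in> V"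
  using assms unfolding totally_transitive_def transitive_system_iff funpow_mult [symmetric]
  by metis

lemma dense_small_periodic_setsE:
  assumes "dense_small_periodic_sets X T" "opene X U"
  obtains y k where "y \<in> U" "k \<ge> 1" "\<And>j. (T ^^ (k * j)) y \<in> U"
proof -
  obtain Y k where Y: "Y \<noteq> {}" "Y \<subseteq> U" "k \<ge> 1" "(T ^^ k) ` Y \<subseteq> Y"
    using assms unfolding dense_small_periodic_sets_def by meson
  obtain y where "y \<in> Y"
    using Y by blast
  have "((T ^^ k) ^^ j) y \<in> Y" for j
    by (induction j) (use \<open>y \<in> Y\<close> Y in auto)
  then show ?thesis
    using that [of y k] Y \<open>y \<in> Y\<close> by (auto simp: funpow_mult)
qed

lemma Trans_iff:
  assumes "tds X T"
  shows "x \<in> Trans X T \<longleftrightarrow> x \<in> topspace X \<and> (\<forall>U N. opene X U \<longrightarrow> (\<exists>m\<ge>N. (T ^^ m) x \<in> U))"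
proof (cases "x \<in> topspace X")
  case True
  have "x \<in> Trans X T \<longleftrightarrow> (\<forall>n. X closure_of {(T ^^ m) x |m. n \<le> m} = topspace X)"
    using True closure_of_subset_topspace [of X]
    by (simp add: Trans_def omega_limit_def) blast
  also have "\<dots> \<longleftrightarrow> (\<forall>n U. opene X U \<longrightarrow> (\<exists>m\<ge>n. (T ^^ m) x \<in> U))"
    unfolding dense_intersects_open opene_def by blast
  finally show ?thesis
    using True by blast
qed (simp add: Trans_def)

section \<open>Transitive points along multiples of \<open>k\<close>\<close>

text \<open>
  A single open set \<open>W\<close> reaches \<open>V\<close> at times in every residue class, so a dense orbit, which enters
  \<open>W\<close> at an unknown time, can be corrected to reach \<open>V\<close> at a multiple of \<open>k\<close>.
\<close>

lemma totally_transitive_residue_times: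
  assumes tt: "totally_transitive X T" and V: "opene X V" and "k \<ge> 1"
  shows "\<exists>W n. opene X W \<and> (\<forall>i<l. n i mod k = i mod k \<and> (\<forall>w\<in>W. (T ^^ n i) w \<in> V))"
proof (induction l)
  case 0
  then show ?case using V by auto
next
  case (Suc l)
  have tds: "tds X T"
    using tt by (simp add: totally_transitive_def)
  obtain W n where W: "opene X W" "\<And>i. i < l \<Longrightarrow> n i mod k = i mod k"
      "\<And>i w. i < l \<Longrightarrow> w \<in> W \<Longrightarrow> (T ^^ n i) w \<in> V"
    using Suc by metis
  \<comment> \<open>As \<open>m \<ge> l\<close>, the point \<open>(T ^^ (m - l)) x\<close> shows
    that the \<open>l\<close>-th preimage of \<open>V\<close> is nonempty; from \<open>W\<close> it
    is then reached in a multiple of \<open>k\<close> steps.\<close>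
  obtain m x where mx: "m \<ge> l" "x \<in> V" "(T ^^ (1 * m)) x \<in> V"
    using totally_transitiveD [OF tt V V, of 1] by auto
  then have "(T ^^ l) ((T ^^ (m - l)) x) \<in> V"
    by (metis comp_apply funpow_add le_add_diff_inverse mult_1)
  then have "opene X {x \<in> topspace X. (T ^^ l) x \<in> V}"
    using mx V tds opene_subset [OF V] tds_funpow_in_topspace [OF tds, of x]
    by (intro opene_Int_preimage [where x = "(T ^^ (m - l)) x"]) (auto simp: opene_def)
  then obtain p w where p: "w \<in> W" "(T ^^ (k * p)) w \<in> {x \<in> topspace X. (T ^^ l) x \<in> V}"
    using totally_transitiveD [OF tt W(1) _ \<open>k \<ge> 1\<close>] by metis
  then have w: "(T ^^ (l + k * p)) w \<in> V"
    by (simp add: funpow_add)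
  \<comment> \<open>The new time is congruent to \<open>l\<close> modulo \<open>k\<close>; the old
    times survive because \<open>W\<close> is only shrunk.\<close>
  define n' where "n' = n(l := l + k * p)"
  have "\<forall>i<Suc l. n' i mod k = i mod k \<and>
      (\<forall>w\<in>{x \<in> W. (T ^^ (l + k * p)) x \<in> V}. (T ^^ n' i) w \<in> V)"
    using W by (auto simp: less_Suc_eq n'_def)
  then show ?case
    using opene_Int_preimage [OF tds W(1) V p(1) w] by blast
qed

lemma Trans_hits_multiples:
  assumes tt: "totally_transitive X T" and x: "x \<in> Trans X T" and V: "opene X V" and "k \<ge> 1"
  shows "\<exists>m. (T ^^ (k * m)) x \<in> V"
proof -
  have tds: "tds X T"
    using tt by (simp add: totally_transitive_def)
  \<comment> \<open>Indices up to \<open>k\<close> inclusive are requested, because the correction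
    \<open>k - p mod k\<close> below equals \<open>k\<close> when \<open>k\<close> divides
    \<open>p\<close>.\<close>
  obtain W n where W: "opene X W" "\<And>i. i < Suc k \<Longrightarrow> n i mod k = i mod k"
      "\<And>i w. i < Suc k \<Longrightarrow> w \<in> W \<Longrightarrow> (T ^^ n i) w \<in> V"
    using totally_transitive_residue_times [OF tt V \<open>k \<ge> 1\<close>, of "Suc k"] by metis
  obtain p where p: "(T ^^ p) x \<in> W"
    using x W(1) Trans_iff [OF tds] by blast
  define i where "i = k - p mod k"
  have "i < Suc k" by (simp add: i_def)
  have "(n i + p) mod k = (i + p mod k) mod k"
    using W(2) [OF \<open>i < Suc k\<close>] by (metis mod_add_cong mod_mod_trivial)
  also have "i + p mod k = k"
    using \<open>k \<ge> 1\<close> by (simp add: i_def)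
  finally obtain m where "n i + p = k * m"
    by (auto simp: mod_eq_0_iff_dvd)
  moreover have "(T ^^ (n i + p)) x \<in> V"
    using W(3) [OF \<open>i < Suc k\<close> p] by (simp add: funpow_add)
  ultimately show ?thesis by metis
qed

section \<open>Weakly thick sets of entering times\<close>

text \<open>A run of length \<open>k * (N + 1)\<close> in \<open>{n. l * n \<in> F}\<close> contains
  a multiple \<open>k * q\<close> with \<open>q > N\<close>, and
  \<open>l * (k * q) = k * (l * q)\<close>.\<close>

lemma weakly_thick_infinite:
  assumes "weakly_thick F" "k \<ge> 1"
  shows "\<exists>n\<ge>N. k * n \<in> F"
proof -
  obtain l where l: "l \<ge> 1" "thick {n. l * n \<in> F}"
    using assms by (auto simp: weakly_thick_def)
  have "k * (N + 1) \<ge> 1"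
    using assms by simp
  then obtain a where a: "{a..a + k * (N + 1)} \<subseteq> {n. l * n \<in> F}"
    using l(2) unfolding thick_def by blast
  define q where "q = a div k + (N + 1)"
  have "k * q = k * (a div k) + k * N + k"
    by (simp add: q_def algebra_simps)
  moreover have "k * (a div k) + a mod k = a" "a mod k < k"
    using assms(2) by simp_all
  ultimately have "a \<le> k * q" "k * q \<le> a + k * (N + 1)"
    unfolding distrib_left by linarith+
  then have "l * (k * q) \<in> F"
    using a by auto
  moreover have "l * q \<ge> N"
    using l(1) by (cases l) (auto simp: q_def)
  ultimately show ?thesis
    by (metis mult.left_commute)
qed

lemma HY_system_Trans_weakly_thick:
  assumes HY: "HY_system X T" and x: "x \<in> Trans X T" and U: "opene X U"
  shows "weakly_thick (entering_times T x U)"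
proof -
  have tt: "totally_transitive X T" and tds: "tds X T"
    using HY by (auto simp: HY_system_def totally_transitive_def)
  obtain y k where y: "y \<in> U" "k \<ge> 1" "\<And>j. (T ^^ (k * j)) y \<in> U"
    using dense_small_periodic_setsE U HY unfolding HY_system_def by metis
  have "\<exists>a. {a..a + n} \<subseteq> {m. k * m \<in> entering_times T x U}" for n
  proof -
    \<comment> \<open>\<open>V\<close> holds the points of \<open>U\<close> that are in
      \<open>U\<close> again at times \<open>k\<close>, ..., \<open>k * n\<close>. The step
      \<open>k\<close> is fixed before \<open>n\<close>, as one \<open>k\<close> must serve all run
      lengths.\<close>
    define V where "V = (\<Inter>j\<in>{..n}. {z \<in> U. (T ^^ (k * j)) z \<in> U})"
    have "openin X V"
      unfolding V_def using opene_Int_preimage [OF tds U U y(1)] y(3)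
      by (intro openin_INT2) (auto simp: opene_def)
    moreover have "y \<in> V"
      using y by (auto simp: V_def)
    ultimately have "opene X V"
      by (auto simp: opene_def)
    then obtain m where m: "(T ^^ (k * m)) x \<in> V"
      using Trans_hits_multiples [OF tt x _ y(2)] by blast
    have "k * (m + j) \<in> entering_times T x U" if "j \<le> n" for j
    proof -
      have "(T ^^ (k * j)) ((T ^^ (k * m)) x) \<in> U"
        using m that unfolding V_def by blast
      then show ?thesis
        by (simp add: entering_times_def funpow_add distrib_left add.commute)
    qed
    then have "i \<in> {m. k * m \<in> entering_times T x U}" if "i \<in> {m..m + n}" for i
      using that by (metis atLeastAtMost_iff le_Suc_ex mem_Collect_eq nat_add_left_cancel_le)
    then show ?thesis by blast
  qed
  then show ?thesis
    using y(2) by (auto simp: weakly_thick_def thick_def)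
qed

text \<open>A weakly thick set has unboundedly many multiples of every \<open>k\<close>, so the
  orbits of \<open>x\<close> under all iterates \<open>T ^^ k\<close> are dense at once; total
  transitivity rests on this.\<close>

lemma Trans_family_F_wt_hits:
  assumes "x \<in> Trans_family F_wt X T" "opene X U" "k \<ge> 1"
  shows "\<exists>n\<ge>N. (T ^^ (k * n)) x \<in> U"
  using assms weakly_thick_infinite [of "entering_times T x U" k N]
  by (auto simp: Trans_family_def F_wt_def entering_times_def)

lemma Trans_family_F_wt_subset:
  assumes "tds X T"
  shows "Trans_family F_wt X T \<subseteq> Trans X T"
proof
  fix x
  assume x: "x \<in> Trans_family F_wt X T"
  then show "x \<in> Trans X T"
    using Trans_family_F_wt_hits [OF x, of _ 1]
    by (auto simp: Trans_iff [OF assms] Trans_family_def)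
qed

section \<open>Existence of transitive points\<close>

text \<open>Total boundedness gives finite nets of mesh \<open>1 / Suc n\<close>; the balls of these
  radii around the net points form a countable base.\<close>

lemma compact_metrizable_imp_second_countable:
  assumes "compact_space X" "metrizable_space X"
  shows "second_countable X"
proof -
  obtain M d where "Metric_space M d" and X: "X = Metric_space.mtopology M d"
    using assms(2) by (auto simp: metrizable_space_def)
  then interpret Metric_space M d
    by simp
  have tb: "mtotally_bounded M"
    using assms(1) compact_space_eq_mcomplete_mtotally_bounded by (simp add: X)
  have "\<exists>K. finite K \<and> K \<subseteq> M \<and> M \<subseteq> (\<Union>x\<in>K. mball x (1 / Suc n))" for n
    using tb unfolding mtotally_bounded_def by simp
  then obtain K where K: "\<And>n. finite (K n)" "\<And>n. K n \<subseteq> M" "\<And>n. M \<subseteq> (\<Union>x\<in>K n. mball x (1 / Suc n))"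
    by metis
  define B where "B = (\<Union>n. (\<lambda>x. mball x (1 / Suc n)) ` K n)"
  have "countable B"
    unfolding B_def using K(1) by (intro countable_UN countable_image) (auto intro: countable_finite)
  moreover have "\<forall>V\<in>B. openin X V"
    by (auto simp: B_def X)
  moreover have "\<exists>V\<in>B. x \<in> V \<and> V \<subseteq> U" if U: "openin X U" "x \<in> U" for U x
  proof -
    obtain r where r: "r > 0" "mball x r \<subseteq> U" "x \<in> M"
      using U unfolding X openin_mtopology by blast
    obtain n where n: "1 / Suc n < r / 2"
      using r(1) nat_approx_posE [of "r / 2"] by auto
    obtain y where y: "y \<in> K n" "x \<in> mball y (1 / Suc n)"
      using K(3) r(3) by blast
    have "mball y (1 / Suc n) \<subseteq> mball x r"
    proof (rule mball_subset)
      show "d y x + 1 / Suc n \<le> r"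
        using y(2) n by simp
      show "x \<in> M" by (fact r(3))
    qed
    then show ?thesis
      using y r(2) by (auto simp: B_def)
  qed
  ultimately show ?thesis
    unfolding second_countable_def by blast
qed

text \<open>Baire category: the points that visit a base set \<open>V\<close> at or after time
  \<open>n\<close> form an open set, dense by transitivity; a point in all these countably many sets
  is transitive.\<close>

lemma transitive_system_imp_Trans_nonempty:
  assumes "transitive_system X T"
  shows "Trans X T \<noteq> {}"
proof -
  have tds: "tds X T"
    and hit: "\<And>U V N. opene X U \<Longrightarrow> opene X V \<Longrightarrow> \<exists>n\<ge>N. \<exists>x\<in>U. (T ^^ n) x \<in> V"
    using assms unfolding transitive_system_iff by blast+
  obtain B where B: "countable B" "\<And>V. V \<in> B \<Longrightarrow> openin X V"
      "\<And>U x. openin X U \<Longrightarrow> x \<in> U \<Longrightarrow> \<exists>V\<in>B. x \<in> V \<and> V \<subseteq> U"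
    using compact_metrizable_imp_second_countable [of X] tds
    unfolding tds_def second_countable_def by metis
  define D where "D V n = (\<Union>m\<in>{n..}. {x \<in> topspace X. (T ^^ m) x \<in> V})" for V and n :: nat
  \<comment> \<open>The empty base set is dropped, since \<open>D {} n\<close> is empty and hence
    not dense.\<close>
  define G where "G = (\<lambda>(V, n). D V n) ` ((B - {{}}) \<times> UNIV)"
  have "X closure_of \<Inter>G = topspace X"
  proof (rule Baire_category)
    show "completely_metrizable_space X \<or> locally_compact_space X \<and> regular_space X"
      using tds by (simp add: tds_def compact_imp_locally_compact_space metrizable_imp_regular_space)
    show "countable G"
      unfolding G_def using B(1) by (intro countable_image countable_SIGMA) auto
    fix S
    assume "S \<in> G"
    then obtain V n where V: "V \<in> B" "V \<noteq> {}" and S: "S = D V n"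
      by (auto simp: G_def)
    then have "opene X V"
      using B(2) by (simp add: opene_def)
    have "openin X S"
      unfolding S D_def using tds B(2) [OF V(1)]
      by (intro openin_Union ballI)
        (auto simp: tds_def intro: openin_continuous_map_preimage continuous_map_funpow)
    moreover have "S \<inter> U \<noteq> {}" if "openin X U" "U \<noteq> {}" for U
      using hit [of U V n] \<open>opene X V\<close> that openin_subset [OF that(1)]
      by (auto simp: opene_def S D_def)
    ultimately show "openin X S \<and> X closure_of S = topspace X"
      by (auto simp: dense_intersects_open)
  qed
  moreover have "topspace X \<noteq> {}"
    using tds by (simp add: tds_def)
  ultimately have "topspace X \<inter> \<Inter>G \<noteq> {}"
    by (metis closure_of_restrict closure_of_empty)
  then obtain x where x: "x \<in> topspace X" "x \<in> \<Inter>G"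
    by blast
  have "\<exists>m\<ge>N. (T ^^ m) x \<in> U" if U: "opene X U" for U N
  proof -
    obtain V where V: "V \<in> B" "V \<noteq> {}" "V \<subseteq> U"
      using U B(3) [of U] by (auto simp: opene_def)
    then have "x \<in> D V N"
      using x(2) by (auto simp: G_def)
    then show ?thesis
      using V(3) by (auto simp: D_def)
  qed
  then have "x \<in> Trans X T"
    using x(1) by (simp add: Trans_iff [OF tds])
  then show ?thesis
    by blast
qed

section \<open>From an \<open>F_wt\<close>-transitive point to an HY-system\<close>

lemma Trans_family_F_wt_imp_totally_transitive:
  assumes tds: "tds X T" and x: "x \<in> Trans_family F_wt X T"
  shows "totally_transitive X T"
  unfolding totally_transitive_def transitive_system_iff
proof (intro conjI allI impI tds tds_funpow)
  fix k N :: nat and U V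
  assume k: "1 \<le> k" and U: "opene X U" and V: "opene X V"
  obtain p where p: "(T ^^ (k * p)) x \<in> U"
    using Trans_family_F_wt_hits [OF x U k] by blast
  obtain q where q: "q \<ge> N + p" "(T ^^ (k * q)) x \<in> V"
    using Trans_family_F_wt_hits [OF x V k] by blast
  have "k * q = k * (q - p) + k * p"
    using q(1) by (simp flip: distrib_left)
  then have "((T ^^ k) ^^ (q - p)) ((T ^^ (k * p)) x) \<in> V"
    using q(2) by (simp add: funpow_mult funpow_add)
  then show "\<exists>n\<ge>N. \<exists>y\<in>U. ((T ^^ k) ^^ n) y \<in> V"
    using p q(1) by (intro exI [of _ "q - p"]) auto
qed

lemma Trans_family_F_wt_imp_dense_small_periodic_sets:
  assumes tds: "tds X T" and x: "x \<in> Trans_family F_wt X T"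
  shows "dense_small_periodic_sets X T"
  unfolding dense_small_periodic_sets_def
proof (intro allI impI)
  fix U
  assume "opene X U"
  \<comment> \<open>Regularity puts a closed \<open>C\<close> between an open \<open>V\<close> and
    \<open>U\<close>: weak thickness concerns visits to open sets, compactness needs closed
    conditions.\<close>
  moreover have "neighbourhood_base_of (closedin X) X"
    using tds by (simp add: tds_def neighbourhood_base_of_closedin metrizable_imp_regular_space)
  ultimately obtain V C where V: "opene X V" "closedin X C" "V \<subseteq> C" "C \<subseteq> U"
    unfolding neighbourhood_base_of opene_def by (metis all_not_in_conv)
  have "weakly_thick (entering_times T x V)"
    using x V(1) by (simp add: Trans_family_def F_wt_def)
  then obtain k where k: "k \<ge> 1" "thick {n. k * n \<in> entering_times T x V}"
    by (auto simp: weakly_thick_def)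
  define D where "D n = (\<Inter>j\<in>{..n}. {y \<in> topspace X. (T ^^ (k * j)) y \<in> C})" for n
  have xX: "x \<in> topspace X"
    using x by (simp add: Trans_family_def)
  have clo: "closedin X (D n)" for n
    unfolding D_def using tds V(2)
    by (intro closedin_INT closedin_continuous_map_preimage [OF continuous_map_funpow])
      (auto simp: tds_def)
  have "D n \<noteq> {}" for n
  proof -
    \<comment> \<open>\<open>thick\<close> only speaks of lengths at least 1, hence
      \<open>n + 1\<close>.\<close>
    obtain a where a: "{a..a + (n + 1)} \<subseteq> {n. k * n \<in> entering_times T x V}"
      using k(2) unfolding thick_def by (metis le_add2)
    have "(T ^^ (k * j)) ((T ^^ (k * a)) x) \<in> C" if "j \<le> n" for j
    proof -
      have "a + j \<in> {n. k * n \<in> entering_times T x V}"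
        using that by (intro subsetD [OF a]) simp
      then have "(T ^^ (k * j + k * a)) x \<in> V"
        by (simp add: entering_times_def distrib_left add.commute)
      then show ?thesis
        using V(3) by (auto simp: funpow_add)
    qed
    then have "(T ^^ (k * a)) x \<in> D n"
      using tds_funpow_in_topspace [OF tds xX] by (simp add: D_def)
    then show ?thesis by blast
  qed
  moreover have "decseq D"
    unfolding decseq_def D_def by (meson INF_superset_mono atMost_subset_iff subset_refl)
  ultimately have "(\<Inter>n. D n) \<noteq> {}"
    using tds clo by (intro compact_space_imp_nest) (auto simp: tds_def)
  moreover have "closedin X (\<Inter>n. D n)"
    using clo by auto
  moreover have "(\<Inter>n. D n) \<subseteq> U"
    using V(4) by (fastforce simp: D_def dest: bspec [of _ _ 0])
  \<comment> \<open>Applying \<open>T ^^ k\<close> shifts \<open>j\<close> to \<open>Suc j\<close>.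
    A single \<open>D n\<close> need not be invariant under this, but the intersection over all
    \<open>n\<close> is.\<close>
  moreover have "(T ^^ k) ` (\<Inter>n. D n) \<subseteq> (\<Inter>n. D n)"
  proof clarify
    fix y n
    assume y: "y \<in> (\<Inter>n. D n)"
    have "(T ^^ (k * j)) ((T ^^ k) y) \<in> C" for j
    proof -
      have "(T ^^ (k * Suc j)) y \<in> C"
        using y by (force simp: D_def)
      then have "(T ^^ (k * j + k)) y \<in> C"
        by (simp add: add.commute)
      then show ?thesis
        by (simp add: funpow_add)
    qed
    moreover have "y \<in> topspace X"
      using y by (auto simp: D_def)
    ultimately show "(T ^^ k) y \<in> D n"
      using tds_funpow_in_topspace [OF tds] by (simp add: D_def)
  qed
  ultimately show "\<exists>Y k. closedin X Y \<and> Y \<noteq> {} \<and> Y \<subseteq> U \<and> k \<ge> 1 \<and> (T ^^ k) ` Y \<subseteq> Y"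
    using k(1) by blast
qed

lemma point_transitive_F_wt_imp_HY_system:
  assumes "tds X T" "point_transitive F_wt X T"
  shows "HY_system X T"
proof -
  obtain x where "x \<in> Trans_family F_wt X T"
    using assms(2) by (auto simp: point_transitive_def)
  then show ?thesis
    using Trans_family_F_wt_imp_totally_transitive [OF assms(1)]
      Trans_family_F_wt_imp_dense_small_periodic_sets [OF assms(1)]
    by (auto simp: HY_system_def)
qed

section \<open>Iterates of an HY-system\<close>

text \<open>The same small set \<open>Y\<close> and period \<open>l\<close> serve, because
  \<open>(T ^^ k) ^^ l = (T ^^ l) ^^ k\<close>.\<close>

lemma HY_system_funpow:
  assumes HY: "HY_system X T" and "k \<ge> 1"
  shows "HY_system X (T ^^ k)"
  unfolding HY_system_def totally_transitive_def
proof (intro conjI allI impI)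
  show "tds X (T ^^ k)"
    using HY by (simp add: HY_system_def totally_transitive_def tds_funpow)
  show "transitive_system X ((T ^^ k) ^^ l)" if "l \<ge> 1" for l
    using HY that \<open>k \<ge> 1\<close> by (simp add: HY_system_def totally_transitive_def funpow_mult)
  show "dense_small_periodic_sets X (T ^^ k)"
    unfolding dense_small_periodic_sets_def
  proof (intro allI impI)
    fix U
    assume "opene X U"
    then obtain Y l where Y: "closedin X Y" "Y \<noteq> {}" "Y \<subseteq> U" "l \<ge> 1" "(T ^^ l) ` Y \<subseteq> Y"
      using HY unfolding HY_system_def dense_small_periodic_sets_def by meson
    have "((T ^^ l) ^^ j) ` Y \<subseteq> Y" for j
      by (induction j) (use Y(5) in auto)
    then have "((T ^^ k) ^^ l) ` Y \<subseteq> Y"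
      by (metis funpow_mult mult.commute)
    then show "\<exists>Y l. closedin X Y \<and> Y \<noteq> {} \<and> Y \<subseteq> U \<and> l \<ge> 1 \<and> ((T ^^ k) ^^ l) ` Y \<subseteq> Y"
      using Y by blast
  qed
qed

section \<open>Finite powers of an HY-system\<close>

text \<open>Carrying a whole progression through the induction leaves room to adjust: the new pair
  is hit at some term of the old progression, and periodicity gives a subprogression serving all
  pairs.\<close>

lemma HY_system_common_progression:
  fixes m :: nat
  assumes HY: "HY_system X T"
    and UV: "\<And>i. i < m \<Longrightarrow> opene X (U i)" "\<And>i. i < m \<Longrightarrow> opene X (V i)"
  shows "\<exists>n k. k \<ge> 1 \<and> (\<forall>i<m. \<forall>j. \<exists>x\<in>U i. (T ^^ (n + k * j)) x \<in> V i)"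
  using UV
proof (induction m)
  case 0
  then show ?case by (auto intro: exI [of _ 1])
next
  case (Suc m)
  have tt: "totally_transitive X T" and tds: "tds X T" and ps: "dense_small_periodic_sets X T"
    using HY by (auto simp: HY_system_def totally_transitive_def)
  obtain n k where k: "k \<ge> 1" and nk: "\<And>i j. i < m \<Longrightarrow> \<exists>x\<in>U i. (T ^^ (n + k * j)) x \<in> V i"
    using Suc.IH Suc.prems by (metis less_SucI)
  have U: "opene X (U m)" and V: "opene X (V m)"
    using Suc.prems by auto
  \<comment> \<open>As \<open>p \<ge> n\<close>, stopping \<open>n\<close> steps before time
    \<open>k * p\<close> gives a point in the \<open>n\<close>-th preimage of
    \<open>V m\<close>.\<close>
  obtain p x where p: "p \<ge> n" "x \<in> U m" "(T ^^ (k * p)) x \<in> V m"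
    using totally_transitiveD [OF tt U V k] by metis
  have "n \<le> k * p"
    using p(1) k by (cases k) auto
  then have V': "opene X {z \<in> topspace X. (T ^^ n) z \<in> V m}"
    using p V tds opene_subset [OF U] tds_funpow_in_topspace [OF tds, of x]
    by (intro opene_Int_preimage [where x = "(T ^^ (k * p - n)) x"])
      (auto simp: opene_def simp flip: funpow_add comp_apply [of "T ^^ n"])
  \<comment> \<open>Reaching that preimage in \<open>k * q\<close> steps makes
    \<open>n + k * q\<close>, a term of the old progression, a hitting time for the new
    pair.\<close>
  obtain q y where q: "y \<in> U m" "(T ^^ (k * q)) y \<in> {z \<in> topspace X. (T ^^ n) z \<in> V m}"
    using totally_transitiveD [OF tt U V' k] by metis
  have "(T ^^ (n + k * q)) y \<in> V m"
    using q(2) by (simp add: funpow_add)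
  then have W: "opene X {z \<in> U m. (T ^^ (n + k * q)) z \<in> V m}"
    using opene_Int_preimage [OF tds U V q(1)] by blast
  \<comment> \<open>Since \<open>z\<close> returns to this set at all multiples of \<open>l\<close>,
    the new pair is hit at every \<open>n + k * q + l * j\<close>; the step \<open>k * l\<close>
    fits both this and the old progression.\<close>
  obtain z l where z: "l \<ge> 1" "\<And>j. (T ^^ (l * j)) z \<in> {z \<in> U m. (T ^^ (n + k * q)) z \<in> V m}"
    using dense_small_periodic_setsE [OF ps W] by metis
  have "\<exists>x\<in>U i. (T ^^ (n + k * q + k * l * j)) x \<in> V i" if "i < Suc m" for i j
  proof (cases "i = m")
    case True
    have "(T ^^ (n + k * q + l * (k * j))) z \<in> V m"
      using z(2) [of "k * j"] unfolding funpow_add [of "n + k * q"] by simp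
    then have "(T ^^ (n + k * q + k * l * j)) z \<in> V m"
      by (simp add: ac_simps)
    then show ?thesis
      using z(2) [of 0] True by auto
  next
    case False
    then show ?thesis
      using nk [of i "q + l * j"] that by (simp add: algebra_simps)
  qed
  moreover have "k * l \<ge> 1"
    using k z(1) by simp
  ultimately show ?case by blast
qed

lemma topspace_power_space: "topspace (power_space X k) = PiE {..<k} (\<lambda>_. topspace X)"
  by (simp add: power_space_def)

text \<open>Extensionality matters at \<open>n = 0\<close>, where the iterate returns
  \<open>x\<close> itself, unrestricted.\<close>

lemma power_map_funpow:
  assumes "x \<in> extensional {..<k}"
  shows "(power_map T k ^^ n) x = (\<lambda>i\<in>{..<k}. (T ^^ n) (x i))"
proof (induction n)
  case 0
  then show ?case
    using assms by (simp add: extensional_restrict)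
next
  case (Suc n)
  then have "(power_map T k ^^ Suc n) x = power_map T k (\<lambda>i\<in>{..<k}. (T ^^ n) (x i))"
    by (simp only: funpow.simps o_apply)
  also have "\<dots> = (\<lambda>i\<in>{..<k}. (T ^^ Suc n) (x i))"
    unfolding power_map_def by (rule restrict_ext) simp
  finally show ?case .
qed

lemma tds_power:
  assumes "tds X T"
  shows "tds (power_space X k) (power_map T k)"
proof -
  have "continuous_map (power_space X k) X (\<lambda>x. T (x i))" if "i < k" for i
  proof -
    have "continuous_map (power_space X k) X (\<lambda>x. x i)"
      unfolding power_space_def using that by (intro continuous_map_product_projection) simp
    then show ?thesis
      using continuous_map_compose [of "power_space X k" X "\<lambda>x. x i" X T] assms
      by (simp add: tds_def o_def)
  qed
  then have "continuous_map (power_space X k) (power_space X k) (power_map T k)"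
    unfolding power_space_def continuous_map_componentwise
    by (auto simp: power_map_def)
  \<comment> \<open>A product of metrizable spaces is metrizable when only countably many factors
    have more than one point; here the index set is finite.\<close>
  moreover have "countable {i \<in> {..<k}. \<not> (\<exists>a. topspace X \<subseteq> {a})}"
    by (rule countable_finite) simp
  ultimately show ?thesis
    using assms unfolding tds_def
    by (auto simp: power_space_def compact_space_product_topology metrizable_space_product_topology PiE_eq_empty_iff)
qed

lemma opene_power_space_box:
  assumes "opene (power_space X k) U"
  obtains u where "\<And>i. i < k \<Longrightarrow> opene X (u i)" "PiE {..<k} u \<subseteq> U"
proof -
  obtain x where "x \<in> U"
    using assms by (auto simp: opene_def)
  then obtain u where "\<forall>i\<in>{..<k}. openin X (u i)" "x \<in> PiE {..<k} u" "PiE {..<k} u \<subseteq> U"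
    using assms unfolding opene_def power_space_def openin_product_topology_alt by blast
  then show ?thesis
    by (intro that [of u]) (auto simp: opene_def PiE_iff)
qed

lemma HY_system_power_transitive:
  assumes HY: "HY_system X T" and "l \<ge> 1"
  shows "transitive_system (power_space X k) (power_map T k ^^ l)"
  unfolding transitive_system_iff
proof (intro conjI allI impI)
  show "tds (power_space X k) (power_map T k ^^ l)"
    using HY by (intro tds_funpow tds_power) (simp add: HY_system_def totally_transitive_def)
  fix U V and N :: nat
  assume U: "opene (power_space X k) U" and V: "opene (power_space X k) V"
  obtain u where u: "\<And>i. i < k \<Longrightarrow> opene X (u i)" "PiE {..<k} u \<subseteq> U"
    using opene_power_space_box [OF U] by metis
  obtain v where v: "\<And>i. i < k \<Longrightarrow> opene X (v i)" "PiE {..<k} v \<subseteq> V"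
    using opene_power_space_box [OF V] by metis
  \<comment> \<open>Used for \<open>T ^^ l\<close>, again an HY-system; the term of index
    \<open>N\<close> is then a common time at least \<open>N\<close>.\<close>
  obtain n c where c: "c \<ge> 1" "\<And>i j. i < k \<Longrightarrow> \<exists>x\<in>u i. ((T ^^ l) ^^ (n + c * j)) x \<in> v i"
    using HY_system_common_progression [OF HY_system_funpow [OF HY \<open>l \<ge> 1\<close>], of k u v] u v by metis
  define m where "m = n + c * N"
  have m: "N \<le> m"
    using c(1) by (simp add: m_def trans_le_add2)
  have "\<forall>i\<in>{..<k}. \<exists>x\<in>u i. (T ^^ (l * m)) x \<in> v i"
    using c(2) by (simp add: m_def funpow_mult)
  then obtain x where x: "\<And>i. i < k \<Longrightarrow> x i \<in> u i" "\<And>i. i < k \<Longrightarrow> (T ^^ (l * m)) (x i) \<in> v i"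
    by (metis lessThan_iff)
  define y where "y = restrict x {..<k}"
  have "y \<in> U"
    unfolding y_def using x(1) by (intro subsetD [OF u(2)]) (auto simp: PiE_iff)
  moreover have "((power_map T k ^^ l) ^^ m) y \<in> PiE {..<k} v"
    using x(2) by (simp add: funpow_mult power_map_funpow y_def cong: restrict_cong)
  ultimately show "\<exists>m\<ge>N. \<exists>y\<in>U. ((power_map T k ^^ l) ^^ m) y \<in> V"
    using m v(2) by blast
qed

lemma dense_small_periodic_sets_power:
  assumes "dense_small_periodic_sets X T"
  shows "dense_small_periodic_sets (power_space X k) (power_map T k)"
  unfolding dense_small_periodic_sets_def
proof (intro allI impI)
  fix U
  assume U: "opene (power_space X k) U"
  obtain u where u: "\<And>i. i < k \<Longrightarrow> opene X (u i)" "PiE {..<k} u \<subseteq> U"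
    using opene_power_space_box [OF U] by metis
  have "\<forall>i\<in>{..<k}. \<exists>Y c. closedin X Y \<and> Y \<noteq> {} \<and> Y \<subseteq> u i \<and> c \<ge> 1 \<and> (T ^^ c) ` Y \<subseteq> Y"
    using assms u(1) unfolding dense_small_periodic_sets_def by (metis lessThan_iff)
  then obtain Y c where Y: "\<And>i. i < k \<Longrightarrow> closedin X (Y i)" "\<And>i. i < k \<Longrightarrow> Y i \<noteq> {}"
      "\<And>i. i < k \<Longrightarrow> Y i \<subseteq> u i" "\<And>i. i < k \<Longrightarrow> c i \<ge> (1::nat)"
      "\<And>i. i < k \<Longrightarrow> (T ^^ c i) ` Y i \<subseteq> Y i"
    unfolding bchoice_iff by (metis lessThan_iff)
  \<comment> \<open>The product of the periods is a multiple of each \<open>c i\<close>, so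
    \<open>T ^^ p\<close> preserves every \<open>Y i\<close>.\<close>
  define p where "p = prod c {..<k}"
  have "p \<ge> 1"
    unfolding p_def using Y(4) by (intro prod_ge_1) auto
  have per: "(T ^^ p) y \<in> Y i" if "i < k" "y \<in> Y i" for i y
  proof -
    obtain q where q: "p = c i * q"
      unfolding p_def using \<open>i < k\<close> by (metis dvd_prodI dvdE finite_lessThan lessThan_iff)
    have "((T ^^ c i) ^^ j) y \<in> Y i" for j
      by (induction j) (use Y(5) [OF \<open>i < k\<close>] that in auto)
    then show ?thesis
      by (simp add: q funpow_mult)
  qed
  have "closedin (power_space X k) (PiE {..<k} Y)"
    unfolding power_space_def closedin_product_topology using Y(1) by auto
  moreover have "PiE {..<k} Y \<noteq> {}"
    using Y(2) by (simp add: PiE_eq_empty_iff)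
  moreover have "PiE {..<k} Y \<subseteq> U"
    using PiE_mono [of "{..<k}" Y u] Y(3) u(2) by auto
  moreover have "(power_map T k ^^ p) ` PiE {..<k} Y \<subseteq> PiE {..<k} Y"
    using per by (auto simp: power_map_funpow PiE_iff)
  ultimately show "\<exists>Y p. closedin (power_space X k) Y \<and> Y \<noteq> {} \<and> Y \<subseteq> U \<and> p \<ge> 1 \<and>
      (power_map T k ^^ p) ` Y \<subseteq> Y"
    using \<open>p \<ge> 1\<close> by blast
qed

lemma HY_system_power:
  assumes "HY_system X T"
  shows "HY_system (power_space X k) (power_map T k)"
  using assms HY_system_power_transitive [OF assms]
  by (simp add: HY_system_def totally_transitive_def tds_power dense_small_periodic_sets_power)

section \<open>Factors, and the return from a power to \<open>X\<close>\<close>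

text \<open>Surjectivity makes preimages of opene sets opene; images of closed sets are closed
  because \<open>X\<close> is compact and \<open>Z\<close> is Hausdorff.\<close>

lemma HY_system_factor:
  assumes HY: "HY_system X T" and tds: "tds Z S"
    and \<pi>: "continuous_map X Z \<pi>" "\<pi> ` topspace X = topspace Z"
    and semi: "\<And>x. x \<in> topspace X \<Longrightarrow> \<pi> (T x) = S (\<pi> x)"
  shows "HY_system Z S"
proof -
  have tdsX: "tds X T"
    using HY by (simp add: HY_system_def totally_transitive_def)
  have semi_n: "\<pi> ((T ^^ n) x) = (S ^^ n) (\<pi> x)" if "x \<in> topspace X" for n x
    by (induction n) (use that semi tds_funpow_in_topspace [OF tdsX that] in auto)
  have pre: "opene X {x \<in> topspace X. \<pi> x \<in> U}" if U: "opene Z U" for U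
  proof -
    have "openin X {x \<in> topspace X. \<pi> x \<in> U}"
      using \<pi>(1) U by (auto simp: opene_def intro: openin_continuous_map_preimage)
    moreover obtain z where "z \<in> U" "z \<in> topspace Z"
      using U opene_subset [OF U] by (auto simp: opene_def)
    ultimately show ?thesis
      using \<pi>(2) by (force simp: opene_def)
  qed
  show ?thesis
    unfolding HY_system_def totally_transitive_def transitive_system_iff
  proof (intro conjI allI impI tds tds_funpow)
    fix k N :: nat and U V
    assume k: "1 \<le> k" and U: "opene Z U" and V: "opene Z V"
    have "totally_transitive X T"
      using HY by (simp add: HY_system_def)
    from totally_transitiveD [OF this pre [OF U] pre [OF V] k, of N]
    obtain m x where m: "m \<ge> N" and x: "x \<in> topspace X" "\<pi> x \<in> U" "\<pi> ((T ^^ (k * m)) x) \<in> V"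
      by blast
    have "((S ^^ k) ^^ m) (\<pi> x) \<in> V"
      using x(3) semi_n [OF x(1)] by (simp add: funpow_mult)
    then show "\<exists>n\<ge>N. \<exists>z\<in>U. ((S ^^ k) ^^ n) z \<in> V"
      using m x(2) by blast
  next
    show "dense_small_periodic_sets Z S"
      unfolding dense_small_periodic_sets_def
    proof (intro allI impI)
      fix U
      assume "opene Z U"
      then obtain Y k where Y: "closedin X Y" "Y \<noteq> {}" "Y \<subseteq> {x \<in> topspace X. \<pi> x \<in> U}" "k \<ge> 1"
          "(T ^^ k) ` Y \<subseteq> Y"
        using pre HY unfolding HY_system_def dense_small_periodic_sets_def by meson
      have "closedin Z (\<pi> ` Y)"
        using tdsX tds Y(1) \<pi>(1)
        by (meson tds_def compactin_imp_closedin metrizable_imp_Hausdorff_space image_compactin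
            closedin_compact_space)
      moreover have "(S ^^ k) ` \<pi> ` Y \<subseteq> \<pi> ` Y"
      proof (intro image_subsetI, elim imageE)
        fix z y
        assume "z = \<pi> y" "y \<in> Y"
        moreover from this have "(S ^^ k) z = \<pi> ((T ^^ k) y)"
          using Y(3) semi_n by auto
        ultimately show "(S ^^ k) z \<in> \<pi> ` Y"
          using Y(5) by auto
      qed
      ultimately show "\<exists>Y k. closedin Z Y \<and> Y \<noteq> {} \<and> Y \<subseteq> U \<and> k \<ge> 1 \<and> (S ^^ k) ` Y \<subseteq> Y"
        using Y by (intro exI [of _ "\<pi> ` Y"] exI [of _ k]) auto
    qed
  qed
qed

text \<open>Coordinate 0, which exists as \<open>k \<ge> 1\<close>, exhibits \<open>X\<close> as a
  factor of its power; constant tuples give surjectivity.\<close>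

lemma HY_system_power_imp:
  assumes "tds X T" "HY_system (power_space X k) (power_map T k)" "k \<ge> 1"
  shows "HY_system X T"
proof (rule HY_system_factor [where \<pi> = "\<lambda>x. x 0"])
  show "continuous_map (power_space X k) X (\<lambda>x. x 0)"
    unfolding power_space_def using assms(3) by (intro continuous_map_product_projection) simp
  have "z \<in> (\<lambda>x. x 0) ` (PiE {..<k} (\<lambda>_. topspace X))" if "z \<in> topspace X" for z
    using that assms(3) by (intro image_eqI [of _ _ "\<lambda>i\<in>{..<k}. z"]) auto
  then show "(\<lambda>x. x 0) ` topspace (power_space X k) = topspace X"
    using assms(3) by (auto simp: topspace_power_space PiE_iff)
  show "power_map T k x 0 = T (x 0)" for x
    using assms(3) by (simp add: power_map_def)
qed (use assms in auto)

theorem theorem4p4: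
  fixes X :: "'a topology" and T :: "'a \<Rightarrow> 'a"
  assumes "tds X T"
  shows "(HY_system X T \<longleftrightarrow> Trans_family F_wt X T = Trans X T \<and> Trans X T \<noteq> {})
       \<and> (HY_system X T \<longleftrightarrow> point_transitive F_wt X T)
       \<and> (HY_system X T \<longleftrightarrow> (\<forall>k\<ge>1. HY_system X (T ^^ k)))
       \<and> (HY_system X T \<longleftrightarrow> (\<forall>k\<ge>1. HY_system (power_space X k) (power_map T k)))"
proof -
  have 12: "Trans_family F_wt X T = Trans X T \<and> Trans X T \<noteq> {}" if HY: "HY_system X T"
  proof
    show "Trans_family F_wt X T = Trans X T"
      using Trans_family_F_wt_subset [OF assms] HY_system_Trans_weakly_thick [OF HY]
      by (auto simp: Trans_family_def F_wt_def Trans_def)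
    have "transitive_system X (T ^^ 1)"
      using HY unfolding HY_system_def totally_transitive_def by blast
    then show "Trans X T \<noteq> {}"
      by (intro transitive_system_imp_Trans_nonempty) simp
  qed
  have 31: "HY_system X T" if "point_transitive F_wt X T"
    using point_transitive_F_wt_imp_HY_system [OF assms that] .
  have 41: "HY_system X T" if "\<forall>k\<ge>1. HY_system X (T ^^ k)"
    using that [rule_format, of 1] by simp
  have 51: "HY_system X T" if "\<forall>k\<ge>1. HY_system (power_space X k) (power_map T k)"
    using HY_system_power_imp [OF assms] that by blast
  \<comment> \<open>The second condition makes \<open>Trans_family F_wt X T\<close> nonempty, which
    is the third; the third leads back to the first.\<close>
  show ?thesis
    using 12 31 41 51 HY_system_funpow HY_system_power unfolding point_transitive_def by metis
qed

end
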